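(* Let $(\mathcal{G},c)$ be a projective crystallograph on $n\geq1$ nodes. Then $\mathcal{G}$ is a disjoint union of the "classical" graphs $\mathcal{G}^{\mathcal{H}_{A_{m-1}}}$, $\mathcal{G}^{\mathcal{H}_{D_m}}$ and $\mathcal{G}^{\mathcal{H}_{B_m}}=\mathcal{G}^{\mathcal{H}_{C_m}}=\mathcal{G}^{\mathcal{H}_{BC_m}}$ (with $m\leq n$), and of the simply-laced bichromatic graphs $\mathcal{G}^{d_1,d_2}$ (with $d_1+d_2\leq n$).
   Context: A projective crystallograph is a graph with unoriented straight edges $\{i,j\}$ ($i\neq j$) and loop edges $\{k\}$, with a colouring of edges such that: every straight edge is red or green, every loop edge is blue, two distinct edges with the same underlying node set have different colours (so at most one red and one green straight edge between any two distinct nodes, and at most one blue loop at each node), and moreover: (1) for any three distinct nodes $i,j,k$, if there are straight edges $\{i,j\}$, $\{j,k\}$ then there is a straight edge $\{i,k\}$, red if the first two have the same colour and green otherwise; (2) if a node $i$ is incident to a (blue) loop edge and to a straight edge $\{i,j\}$, then both the red and the green straight edge $\{i,j\}$ are present, as well as a (blue) loop edge at $j$. Classical graphs on $m\ge1$ nodes: $\mathcal{G}^{\mathcal{H}_{A_{m-1}}}$ has exactly all red straight edges (an isolated node for $m=1$); $\mathcal{G}^{\mathcal{H}_{D_m}}$ has exactly all red and green straight edges and no loops; $\mathcal{G}^{\mathcal{H}_{B_m}}=\mathcal{G}^{\mathcal{H}_{C_m}}=\mathcal{G}^{\mathcal{H}_{BC_m}}$ has all red and green straight edges and a blue loop at every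 node. For $d_1,d_2\ge1$, $\mathcal{G}^{d_1,d_2}$ is the graph without loops on $I_1\sqcup I_2$, $|I_i|=d_i$, whose red edges are exactly all pairs of distinct nodes in the same part and whose green edges are exactly all pairs of nodes in different parts. Types of graphs are understood up to relabelling nodes. *)

theory Defs
  imports Main
begin

datatype edge_colour = Red | Green | Blue

text \<open>
  Unoriented edge-coloured multigraphs. Edges are abstract objects; \<open>ends e\<close> is the
  underlying node set of \<open>e\<close>, with two elements for a straight edge and one for a loop.
\<close>

record ('v, 'e) coloured_graph =
  nodes :: "'v set"
  edges :: "'e set"
  ends :: "'e \<Rightarrow> 'v set"
  colour :: "'e \<Rightarrow> edge_colour"

definition straight_edge :: "('v, 'e) coloured_graph \<Rightarrow> 'e \<Rightarrow> 'v \<Rightarrow> 'v \<Rightarrow> bool" where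
  "straight_edge G e i j \<longleftrightarrow> e \<in> edges G \<and> i \<noteq> j \<and> ends G e = {i, j}"

definition loop_edge :: "('v, 'e) coloured_graph \<Rightarrow> 'e \<Rightarrow> 'v \<Rightarrow> bool" where
  "loop_edge G e k \<longleftrightarrow> e \<in> edges G \<and> ends G e = {k}"

definition coloured_multigraph :: "('v, 'e) coloured_graph \<Rightarrow> bool" where
  "coloured_multigraph G \<longleftrightarrow>
     (\<forall>e \<in> edges G. (\<exists>i\<in>nodes G. \<exists>j\<in>nodes G. straight_edge G e i j) \<or>
                     (\<exists>k\<in>nodes G. loop_edge G e k))"

definition projective_crystallograph :: "('v, 'e) coloured_graph \<Rightarrow> bool" where
  "projective_crystallograph G \<longleftrightarrow>
     coloured_multigraph G \<and>
     (\<forall>e i j. straight_edge G e i j \<longrightarrow> colour G e = Red \<or> colour G e = Green) \<and>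
     (\<forall>e k. loop_edge G e k \<longrightarrow> colour G e = Blue) \<and>
     (\<forall>e\<in>edges G. \<forall>f\<in>edges G. e \<noteq> f \<longrightarrow> ends G e = ends G f \<longrightarrow> colour G e \<noteq> colour G f) \<and>
     (\<forall>i j k e f. i \<noteq> k \<longrightarrow> straight_edge G e i j \<longrightarrow> straight_edge G f j k \<longrightarrow>
        (\<exists>g. straight_edge G g i k \<and>
             colour G g = (if colour G e = colour G f then Red else Green))) \<and>
     (\<forall>i j l e. loop_edge G l i \<longrightarrow> straight_edge G e i j \<longrightarrow>
        (\<exists>r. straight_edge G r i j \<and> colour G r = Red) \<and>
        (\<exists>g. straight_edge G g i j \<and> colour G g = Green) \<and>
        (\<exists>b. loop_edge G b j \<and> colour G b = Blue))"

definition graph_iso :: "('v, 'e) coloured_graph \<Rightarrow> ('w, 'f) coloured_graph \<Rightarrow> bool"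
    (infix "\<cong>\<^sub>G" 50) where
  "G \<cong>\<^sub>G H \<longleftrightarrow>
     (\<exists>\<phi> \<psi>. bij_betw \<phi> (nodes G) (nodes H) \<and> bij_betw \<psi> (edges G) (edges H) \<and>
        (\<forall>e\<in>edges G. ends H (\<psi> e) = \<phi> ` ends G e \<and> colour H (\<psi> e) = colour G e))"

definition disjoint_union ::
    "'i set \<Rightarrow> ('i \<Rightarrow> ('v, 'e) coloured_graph) \<Rightarrow> ('i \<times> 'v, 'i \<times> 'e) coloured_graph" where
  "disjoint_union I H =
     \<lparr>nodes = (SIGMA i:I. nodes (H i)),
      edges = (SIGMA i:I. edges (H i)),
      ends = (\<lambda>(i, e). Pair i ` ends (H i) e),
      colour = (\<lambda>(i, e). colour (H i) e)\<rparr>"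

text \<open>The standard graphs below have at most one edge per node set and colour, so there an edge
  is taken to be the pair of its node set and its colour.\<close>

type_synonym standard_graph = "(nat, nat set \<times> edge_colour) coloured_graph"

definition standard_graph ::
    "nat set \<Rightarrow> (nat set \<times> edge_colour) set \<Rightarrow> standard_graph" where
  "standard_graph N E = \<lparr>nodes = N, edges = E, ends = fst, colour = snd\<rparr>"

text \<open>All graphs are parametrised by numbers of nodes; in particular \<open>graph_A m\<close> is the graph of
  the arrangement of type \<open>A\<^sub>m\<^sub>-\<^sub>1\<close>, and \<open>graph_BC m\<close> is the common graph of types
  \<open>B\<^sub>m\<close>, \<open>C\<^sub>m\<close> and \<open>BC\<^sub>m\<close>.\<close>

definition graph_A :: "nat \<Rightarrow> standard_graph" where
  "graph_A m = standard_graph {..<m} {({i, j}, Red) | i j. i < m \<and> j < m \<and> i \<noteq> j}"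

definition graph_D :: "nat \<Rightarrow> standard_graph" where
  "graph_D m = standard_graph {..<m}
     {({i, j}, c) | i j c. i < m \<and> j < m \<and> i \<noteq> j \<and> c \<in> {Red, Green}}"

definition graph_BC :: "nat \<Rightarrow> standard_graph" where
  "graph_BC m = standard_graph {..<m}
     ({({i, j}, c) | i j c. i < m \<and> j < m \<and> i \<noteq> j \<and> c \<in> {Red, Green}} \<union>
      {({k}, Blue) | k. k < m})"

text \<open>The two parts are \<open>{..<d1}\<close> and \<open>{d1..<d1 + d2}\<close>.\<close>

definition graph_bichromatic :: "nat \<Rightarrow> nat \<Rightarrow> standard_graph" where
  "graph_bichromatic d1 d2 = standard_graph {..<d1 + d2}
     ({({i, j}, Red) | i j. i < d1 \<and> j < d1 \<and> i \<noteq> j} \<union>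
      {({i, j}, Red) | i j. i \<in> {d1..<d1 + d2} \<and> j \<in> {d1..<d1 + d2} \<and> i \<noteq> j} \<union>
      {({i, j}, Green) | i j. i < d1 \<and> j \<in> {d1..<d1 + d2}})"

end

theory Submission
  imports Defs
begin

text \<open>
  By the triangle condition, being equal or joined by a straight edge is a transitive relation, so
  a crystallograph is the disjoint union of the subgraphs induced on the classes of this equivalence
  relation, and inside a class any two distinct nodes are joined. It remains to classify such complete
  pieces. Reading red as \<open>+\<close> and green as \<open>-\<close>, the triangle condition multiplies colours along paths.
  A blue loop somewhere propagates to the whole piece and forces all red and green edges: the piece
  is of type \<open>BC\<close>. Without loops, a pair joined in both colours makes every pair so (a path
  through that pair can be given either sign): type \<open>D\<close>. If every pair has
  exactly one colour, the sign of a pair is the product of the signs of its members relative to a base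
  node, so the base node splits the piece into its red side and its green side: this is
  the bichromatic graph, or type \<open>A\<close> if the green side is empty.

  Edges are determined by their ends and colour, so isomorphisms onto the standard graphs can
  be checked on the adjacency relations alone (\<open>iso_standard_graph\<close>); the pieces are put
  together by \<open>iso_disjoint_union_of_partition\<close>.
\<close>

section \<open>Adjacency relations of a crystallograph\<close>

definition joined :: "('v, 'e) coloured_graph \<Rightarrow> edge_colour \<Rightarrow> 'v \<Rightarrow> 'v \<Rightarrow> bool" where
  "joined G c i j \<longleftrightarrow> (\<exists>e. straight_edge G e i j \<and> colour G e = c)"

definition looped :: "('v, 'e) coloured_graph \<Rightarrow> 'v \<Rightarrow> bool" where
  "looped G k \<longleftrightarrow> (\<exists>e. loop_edge G e k)"

lemma joined_sym: "joined G c i j \<Longrightarrow> joined G c j i"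
  unfolding joined_def straight_edge_def by (metis insert_commute)

lemma joined_distinct: "joined G c i j \<Longrightarrow> i \<noteq> j"
  unfolding joined_def straight_edge_def by blast

lemma ends_cases:
  assumes "coloured_multigraph G" "e \<in> edges G"
  obtains (straight) i j where "i \<in> nodes G" "j \<in> nodes G" "straight_edge G e i j"
    | (loop) k where "k \<in> nodes G" "loop_edge G e k"
  using assms unfolding coloured_multigraph_def by blast

lemma ends_subset_nodes:
  assumes "coloured_multigraph G" "e \<in> edges G"
  shows "ends G e \<subseteq> nodes G"
  using assms
  by (cases rule: ends_cases) (auto simp: straight_edge_def loop_edge_def)

lemma crystallograph_multigraph: "projective_crystallograph G \<Longrightarrow> coloured_multigraph G"
  unfolding projective_crystallograph_def by (elim conjE)

lemma joined_nodes:
  assumes "projective_crystallograph G" "joined G c i j"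
  shows "i \<in> nodes G" "j \<in> nodes G"
proof -
  obtain e where "e \<in> edges G" "ends G e = {i, j}"
    using assms(2) unfolding joined_def straight_edge_def by blast
  then have "{i, j} \<subseteq> nodes G"
    using ends_subset_nodes[OF crystallograph_multigraph[OF assms(1)]] by metis
  then show "i \<in> nodes G" "j \<in> nodes G" by simp_all
qed

lemma looped_node:
  assumes "projective_crystallograph G" "looped G k"
  shows "k \<in> nodes G"
proof -
  obtain e where "e \<in> edges G" "ends G e = {k}"
    using assms(2) unfolding looped_def loop_edge_def by blast
  then have "{k} \<subseteq> nodes G"
    using ends_subset_nodes[OF crystallograph_multigraph[OF assms(1)]] by metis
  then show ?thesis by simp
qed

lemma joined_colour:
  assumes "projective_crystallograph G" "joined G c i j"
  shows "c = Red \<or> c = Green"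
proof -
  have "\<forall>e i j. straight_edge G e i j \<longrightarrow> colour G e = Red \<or> colour G e = Green"
    using assms(1) unfolding projective_crystallograph_def by (elim conjE)
  then show ?thesis using assms(2) unfolding joined_def by blast
qed

lemma loop_edge_blue:
  assumes "projective_crystallograph G" "loop_edge G e k"
  shows "colour G e = Blue"
proof -
  have "\<forall>e k. loop_edge G e k \<longrightarrow> colour G e = Blue"
    using assms(1) unfolding projective_crystallograph_def by (elim conjE)
  then show ?thesis using assms(2) by blast
qed

lemma joined_triangle:
  assumes G: "projective_crystallograph G"
    and "joined G c i j" "joined G d j k" "i \<noteq> k"
  shows "joined G (if c = d then Red else Green) i k"
proof -
  have "\<forall>i j k e f. i \<noteq> k \<longrightarrow> straight_edge G e i j \<longrightarrow> straight_edge G f j k \<longrightarrow>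
        (\<exists>g. straight_edge G g i k \<and>
             colour G g = (if colour G e = colour G f then Red else Green))"
    using G unfolding projective_crystallograph_def by (elim conjE)
  then show ?thesis
    using assms(2-4) unfolding joined_def by blast
qed

lemma looped_joined:
  assumes "projective_crystallograph G" "looped G i" "joined G c i j"
  shows "joined G Red i j" "joined G Green i j" "looped G j"
proof -
  have "\<forall>i j l e. loop_edge G l i \<longrightarrow> straight_edge G e i j \<longrightarrow>
        (\<exists>r. straight_edge G r i j \<and> colour G r = Red) \<and>
        (\<exists>g. straight_edge G g i j \<and> colour G g = Green) \<and>
        (\<exists>b. loop_edge G b j \<and> colour G b = Blue)"
    using assms(1) unfolding projective_crystallograph_def by (elim conjE)
  then show "joined G Red i j" "joined G Green i j" "looped G j"
    using assms(2,3) unfolding joined_def looped_def by blast+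
qed

lemma crystallograph_edge_eqI:
  assumes "projective_crystallograph G" "e \<in> edges G" "f \<in> edges G"
    and "ends G e = ends G f" "colour G e = colour G f"
  shows "e = f"
proof -
  have "\<forall>e\<in>edges G. \<forall>f\<in>edges G. e \<noteq> f \<longrightarrow> ends G e = ends G f \<longrightarrow> colour G e \<noteq> colour G f"
    using assms(1) unfolding projective_crystallograph_def by (elim conjE)
  then show ?thesis using assms(2-) by blast
qed

section \<open>Isomorphisms onto standard graphs\<close>

text \<open>Since no two edges share both their ends and their colour, mapping an edge to the pair of the
  image of its ends and its colour is injective. So a relabelling of the nodes that matches the
  relations \<open>joined\<close> and \<open>looped\<close> is already an isomorphism.\<close>

lemma iso_standard_graph:
  fixes f :: "'v \<Rightarrow> nat"
  assumes G: "projective_crystallograph G"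
    and f: "bij_betw f (nodes G) {..<m}"
    and R: "\<And>c i j. \<lbrakk>i \<in> nodes G; j \<in> nodes G; i \<noteq> j\<rbrakk> \<Longrightarrow> joined G c i j \<longleftrightarrow> R c (f i) (f j)"
    and L: "\<And>k. k \<in> nodes G \<Longrightarrow> looped G k \<longleftrightarrow> L (f k)"
  shows "G \<cong>\<^sub>G standard_graph {..<m}
    ({({i, j}, c) | i j c. i < m \<and> j < m \<and> i \<noteq> j \<and> R c i j} \<union> {({k}, Blue) | k. k < m \<and> L k})"
    (is "_ \<cong>\<^sub>G standard_graph _ (?S \<union> ?B)")
proof -
  let ?\<psi> = "\<lambda>e. (f ` ends G e, colour G e)"
  note mg = crystallograph_multigraph[OF G]
  have f_inj: "inj_on f (nodes G)" and f_im: "f ` nodes G = {..<m}"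
    using f by (auto simp: bij_betw_def)
  have onto: "\<exists>i\<in>nodes G. f i = a" if "a < m" for a
    using that f_im by (metis imageE lessThan_iff)
  have "inj_on ?\<psi> (edges G)"
    using crystallograph_edge_eqI[OF G] ends_subset_nodes[OF mg] f_inj
    by (auto intro!: inj_onI simp: inj_on_image_eq_iff)
  moreover have "?\<psi> ` edges G = ?S \<union> ?B"
  proof (intro equalityI subsetI)
    fix p assume "p \<in> ?\<psi> ` edges G"
    then obtain e where e: "e \<in> edges G" and p: "p = ?\<psi> e" by blast
    from mg e show "p \<in> ?S \<union> ?B"
    proof (cases rule: ends_cases)
      case (straight i j)
      then have "joined G (colour G e) i j" "i \<noteq> j"
        unfolding joined_def straight_edge_def by blast+
      then have "R (colour G e) (f i) (f j)" "f i \<noteq> f j" "f i < m" "f j < m"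
        using R straight(1,2) f_inj f_im by (auto dest: inj_onD)
      moreover have "p = ({f i, f j}, colour G e)"
        using straight(3) p by (simp add: straight_edge_def)
      ultimately show ?thesis by blast
    next
      case (loop k)
      then have "L (f k)" "f k < m"
        using L f_im unfolding looped_def by blast+
      moreover have "p = ({f k}, Blue)"
        using loop(2) p loop_edge_blue[OF G] by (simp add: loop_edge_def)
      ultimately show ?thesis by blast
    qed
  next
    fix p assume "p \<in> ?S \<union> ?B"
    then show "p \<in> ?\<psi> ` edges G"
    proof
      assume "p \<in> ?S"
      then obtain a b c where ab: "a < m" "b < m" "a \<noteq> b" "R c a b" and p: "p = ({a, b}, c)"
        by blast
      from onto[OF ab(1)] onto[OF ab(2)]
      obtain i j where ij: "i \<in> nodes G" "j \<in> nodes G" "f i = a" "f j = b"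
        by metis
      then have "joined G c i j"
        using R[of i j c] ab by auto
      then obtain e where "e \<in> edges G" "ends G e = {i, j}" "colour G e = c"
        unfolding joined_def straight_edge_def by blast
      with p ij have "e \<in> edges G" "p = ?\<psi> e" by simp_all
      then show ?thesis by blast
    next
      assume "p \<in> ?B"
      then obtain a where a: "a < m" "L a" and p: "p = ({a}, Blue)" by blast
      from onto[OF a(1)] obtain k where "k \<in> nodes G" and k: "f k = a" by blast
      then have "looped G k" using L a(2) by simp
      then obtain e where e: "loop_edge G e k" unfolding looped_def by blast
      then have "e \<in> edges G" "p = ?\<psi> e"
        using loop_edge_blue[OF G e] p k by (simp_all add: loop_edge_def)
      then show ?thesis by blast
    qed
  qed
  ultimately have "bij_betw ?\<psi> (edges G) (?S \<union> ?B)" by (simp add: bij_betw_def)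
  then show ?thesis
    unfolding graph_iso_def using f
    by (intro exI[of _ f] exI[of _ ?\<psi>]) (simp add: standard_graph_def)
qed

section \<open>Complete crystallographs\<close>

definition complete_graph :: "('v, 'e) coloured_graph \<Rightarrow> bool" where
  "complete_graph G \<longleftrightarrow> (\<forall>i\<in>nodes G. \<forall>j\<in>nodes G. i \<noteq> j \<longrightarrow> (\<exists>c. joined G c i j))"

lemma complete_looped:
  assumes G: "projective_crystallograph G" and K: "complete_graph G"
    and "looped G x" and i: "i \<in> nodes G"
  shows "looped G i"
proof (cases "i = x")
  case False
  have "x \<in> nodes G" using G assms(3) by (rule looped_node)
  then obtain c where "joined G c x i"
    using K i False unfolding complete_graph_def by metis
  with G assms(3) show ?thesis by (rule looped_joined)
qed (use assms(3) in simp)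

lemma complete_looped_iso_BC:
  assumes G: "projective_crystallograph G" and fin: "finite (nodes G)"
    and K: "complete_graph G" and x: "looped G x"
  shows "G \<cong>\<^sub>G graph_BC (card (nodes G))"
proof -
  let ?m = "card (nodes G)"
  obtain f where f: "bij_betw f (nodes G) {..<?m}"
    using ex_bij_betw_finite_nat[OF fin] by (auto simp: atLeast0LessThan)
  have "joined G c i j \<longleftrightarrow> c \<in> {Red, Green}"
    if ij: "i \<in> nodes G" "j \<in> nodes G" "i \<noteq> j" for c i j
  proof -
    obtain d where "joined G d i j"
      using ij K unfolding complete_graph_def by blast
    from looped_joined(1,2)[OF G complete_looped[OF G K x ij(1)] this] show ?thesis
      using joined_colour[OF G, of c i j] by auto
  qed
  then have "G \<cong>\<^sub>G standard_graph {..<?m}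
    ({({i, j}, c) | i j c. i < ?m \<and> j < ?m \<and> i \<noteq> j \<and> c \<in> {Red, Green}} \<union>
     {({k}, Blue) | k. k < ?m \<and> True})"
    using complete_looped[OF G K x] by (intro iso_standard_graph[OF G f, where L = "\<lambda>_. True"]) auto
  then show ?thesis by (simp add: graph_BC_def)
qed

text \<open>A doubled pair \<open>{x, y}\<close> spreads in two steps: for \<open>j \<notin> {x, y}\<close> the paths \<open>x y j\<close> differing only
  in the edge from \<open>x\<close> to \<open>y\<close> give both colours between \<open>x\<close> and \<open>j\<close>; so \<open>x\<close> is doubly joined to
  everything, and any \<open>i\<close> is doubly joined to any \<open>j\<close> by paths through \<open>x\<close>.\<close>

lemma complete_doubled:
  assumes G: "projective_crystallograph G" and K: "complete_graph G"
    and xy: "joined G Red x y" "joined G Green x y"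
    and ij: "i \<in> nodes G" "j \<in> nodes G" "i \<noteq> j"
  shows "joined G Red i j \<and> joined G Green i j"
proof -
  have step: "joined G Red a d \<and> joined G Green a d"
    if ab: "joined G Red a b" "joined G Green a b" and bd: "joined G c b d" and ad: "a \<noteq> d"
    for a b c d
    using joined_triangle[OF G ab(1) bd ad] joined_triangle[OF G ab(2) bd ad]
      joined_colour[OF G bd] by auto
  have from_x: "joined G Red x d \<and> joined G Green x d" if d: "d \<in> nodes G" "d \<noteq> x" for d
  proof (cases "d = y")
    case False
    have "y \<in> nodes G" using G xy(1) by (rule joined_nodes)
    then obtain c where c: "joined G c y d"
      using K d(1) False unfolding complete_graph_def by metis
    show ?thesis using step[OF xy c] d(2) by simp
  qed (use xy in blast)
  show ?thesis
  proof (cases "i = x \<or> j = x")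
    case True
    then show ?thesis
      using from_x[of i] from_x[of j] ij joined_sym[of G _ x i] by auto
  next
    case False
    then have "joined G Red i x" "joined G Green i x" "joined G Red x j"
      using from_x[of i] from_x[of j] ij joined_sym[of G _ x i] by auto
    then show ?thesis using ij(3) by (rule step)
  qed
qed

lemma complete_doubled_iso_D:
  assumes G: "projective_crystallograph G" and fin: "finite (nodes G)"
    and K: "complete_graph G" and L: "\<And>k. \<not> looped G k"
    and xy: "joined G Red x y" "joined G Green x y"
  shows "G \<cong>\<^sub>G graph_D (card (nodes G))"
proof -
  let ?m = "card (nodes G)"
  obtain f where f: "bij_betw f (nodes G) {..<?m}"
    using ex_bij_betw_finite_nat[OF fin] by (auto simp: atLeast0LessThan)
  have "joined G c i j \<longleftrightarrow> c \<in> {Red, Green}" if "i \<in> nodes G" "j \<in> nodes G" "i \<noteq> j" for c i j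
    using complete_doubled[OF G K xy that] joined_colour[OF G, of c i j] by auto
  then have "G \<cong>\<^sub>G standard_graph {..<?m}
    ({({i, j}, c) | i j c. i < ?m \<and> j < ?m \<and> i \<noteq> j \<and> c \<in> {Red, Green}} \<union>
     {({k}, Blue) | k. k < ?m \<and> False})"
    using L by (intro iso_standard_graph[OF G f, where L = "\<lambda>_. False"]) auto
  then show ?thesis by (simp add: graph_D_def)
qed

text \<open>The base node belongs to its own red side. Two nodes other than \<open>x\<close> are joined through \<open>x\<close> by
  a red edge exactly if their edges to \<open>x\<close> have the same colour, and uniqueness of colours leaves
  no other edge between them.\<close>

lemma complete_simple_colour:
  assumes G: "projective_crystallograph G" and K: "complete_graph G"
    and S: "\<And>i j. \<not> (joined G Red i j \<and> joined G Green i j)"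
    and x: "x \<in> nodes G" and ij: "i \<in> nodes G" "j \<in> nodes G" "i \<noteq> j"
  defines "side \<equiv> \<lambda>i. i = x \<or> joined G Red x i"
  shows "joined G c i j \<longleftrightarrow> c = (if side i = side j then Red else Green)"
proof -
  have green: "joined G Green x k \<longleftrightarrow> \<not> side k" if "k \<in> nodes G" for k
    using that K x S joined_colour[OF G] joined_distinct
    unfolding side_def complete_graph_def by metis
  define col where "col k = (if side k then Red else Green)" for k
  have base: "joined G (col k) x k" if "k \<in> nodes G" "k \<noteq> x" for k
    using that green[OF that(1)] by (auto simp: col_def side_def)
  have "side x" by (simp add: side_def)
  consider "i = x" "j \<noteq> x" | "j = x" "i \<noteq> x" | "i \<noteq> x" "j \<noteq> x"
    using ij(3) by blast
  then have "joined G (if side i = side j then Red else Green) i j"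
  proof cases
    case 1
    then show ?thesis using base[OF ij(2)] \<open>side x\<close> by (simp add: col_def)
  next
    case 2
    then show ?thesis using joined_sym[OF base[OF ij(1)]] \<open>side x\<close> by (simp add: col_def)
  next
    case 3
    from joined_triangle[OF G joined_sym[OF base[OF ij(1) 3(1)]] base[OF ij(2) 3(2)] ij(3)]
    have "joined G (if col i = col j then Red else Green) i j" .
    then show ?thesis by (simp add: col_def split: if_splits)
  qed
  then show ?thesis
    using S[of i j] joined_colour[OF G, of c i j] by (auto split: if_splits)
qed

lemma complete_simple_iso:
  assumes G: "projective_crystallograph G" and fin: "finite (nodes G)"
    and K: "complete_graph G" and L: "\<And>k. \<not> looped G k"
    and S: "\<And>i j. \<not> (joined G Red i j \<and> joined G Green i j)"
    and x: "x \<in> nodes G"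
  shows "G \<cong>\<^sub>G graph_A (card (nodes G)) \<or>
    (\<exists>d1 d2. 1 \<le> d1 \<and> 1 \<le> d2 \<and> d1 + d2 = card (nodes G) \<and> G \<cong>\<^sub>G graph_bichromatic d1 d2)"
proof -
  let ?m = "card (nodes G)"
  define I1 where "I1 = {i \<in> nodes G. i = x \<or> joined G Red x i}"
  define I2 where "I2 = nodes G - I1"
  define d1 d2 where "d1 = card I1" and "d2 = card I2"
  have fin12: "finite I1" "finite I2" and un: "I1 \<union> I2 = nodes G" and disj: "I1 \<inter> I2 = {}"
    using fin by (auto simp: I1_def I2_def)
  have m: "d1 + d2 = ?m"
    unfolding d1_def d2_def by (metis card_Un_disjoint fin12 un disj)
  have "1 \<le> d1"
    using x fin12(1) by (auto simp: d1_def I1_def Suc_le_eq card_gt_0_iff)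
  obtain g where g: "bij_betw g I1 {..<d1}"
    using ex_bij_betw_finite_nat[OF fin12(1)] by (auto simp: atLeast0LessThan d1_def)
  \<comment> \<open>The red side of \<open>x\<close> receives the initial labels, so that the sides become the two standard parts.\<close>
  have "\<exists>h. bij_betw h I2 {d1..<d1 + d2}"
    using fin12(2) by (rule finite_same_card_bij) (simp_all add: d2_def)
  then obtain h where h: "bij_betw h I2 {d1..<d1 + d2}" by blast
  define f where "f i = (if i \<in> I1 then g i else h i)" for i
  have "bij_betw f I1 {..<d1}"
    using g by (subst bij_betw_cong[of _ _ g]) (auto simp: f_def)
  moreover have "bij_betw f I2 {d1..<d1 + d2}"
    using h disj by (subst bij_betw_cong[of _ _ h]) (auto simp: f_def)
  ultimately have f: "bij_betw f (nodes G) {..<d1 + d2}"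
    and side: "\<And>i. i \<in> nodes G \<Longrightarrow> f i < d1 \<longleftrightarrow> i \<in> I1"
  proof -
    assume 1: "bij_betw f I1 {..<d1}" and 2: "bij_betw f I2 {d1..<d1 + d2}"
    have "bij_betw f (I1 \<union> I2) ({..<d1} \<union> {d1..<d1 + d2})"
      using 1 2 by (rule bij_betw_combine) auto
    moreover have "{..<d1} \<union> {d1..<d1 + d2} = {..<d1 + d2}" by auto
    ultimately show "bij_betw f (nodes G) {..<d1 + d2}" using un by simp
    show "f i < d1 \<longleftrightarrow> i \<in> I1" if "i \<in> nodes G" for i
    proof (cases "i \<in> I1")
      case True
      then show ?thesis using bij_betwE[OF 1] by auto
    next
      case False
      then have "i \<in> I2" using that by (simp add: I2_def)
      then have "d1 \<le> f i" using bij_betwE[OF 2] by auto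
      then show ?thesis using False by simp
    qed
  qed
  have "joined G c i j \<longleftrightarrow> c = (if (f i < d1) = (f j < d1) then Red else Green)"
    if "i \<in> nodes G" "j \<in> nodes G" "i \<noteq> j" for c i j
    using complete_simple_colour[OF G K S x that] that by (simp add: side I1_def)
  then have iso: "G \<cong>\<^sub>G standard_graph {..<d1 + d2}
    ({({i, j}, c) | i j c. i < d1 + d2 \<and> j < d1 + d2 \<and> i \<noteq> j \<and>
        c = (if (i < d1) = (j < d1) then Red else Green)} \<union>
     {({k}, Blue) | k. k < d1 + d2 \<and> False})"
    (is "_ \<cong>\<^sub>G standard_graph _ (?S \<union> _)")
    using L by (intro iso_standard_graph[OF G f, where L = "\<lambda>_. False"]) auto
  show ?thesis
  proof (cases "d2 = 0")
    case True
    have "?S = {({i, j}, Red) | i j. i < d1 \<and> j < d1 \<and> i \<noteq> j}"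
      using True by force
    then show ?thesis using iso True m by (simp add: graph_A_def)
  next
    case False
    \<comment> \<open>In \<open>?S\<close> a green pair may be listed from either part; \<open>?C\<close> lists it starting from the first.\<close>
    have "?S = {({i, j}, Red) | i j. i < d1 \<and> j < d1 \<and> i \<noteq> j} \<union>
      {({i, j}, Red) | i j. i \<in> {d1..<d1 + d2} \<and> j \<in> {d1..<d1 + d2} \<and> i \<noteq> j} \<union>
      {({i, j}, Green) | i j. i < d1 \<and> j \<in> {d1..<d1 + d2}}" (is "_ = ?A \<union> ?B \<union> ?C")
    proof (intro equalityI subsetI)
      fix p assume "p \<in> ?S"
      then obtain i j where ij: "i < d1 + d2" "j < d1 + d2" "i \<noteq> j"
        and p: "p = ({i, j}, if (i < d1) = (j < d1) then Red else Green)" by blast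
      consider "i < d1" "j < d1" | "\<not> i < d1" "\<not> j < d1" | "i < d1" "\<not> j < d1" | "\<not> i < d1" "j < d1"
        by blast
      then show "p \<in> ?A \<union> ?B \<union> ?C"
      proof cases
        case 3
        then have "p = ({i, j}, Green)" using p by simp
        moreover have "j \<in> {d1..<d1 + d2}" using 3 ij by simp
        ultimately show ?thesis using 3(1) by blast
      next
        case 4
        then have "p = ({j, i}, Green)" using p by (simp add: insert_commute)
        moreover have "i \<in> {d1..<d1 + d2}" using 4 ij by simp
        ultimately show ?thesis using 4(2) by blast
      qed (use ij p in auto)
    next
      \<comment> \<open>The name keeps the simplifier from unfolding the comprehension.\<close>
      define S where "S = ?S"
      have mem: "({i, j}, if (i < d1) = (j < d1) then Red else Green) \<in> S"
        if "i < d1 + d2" "j < d1 + d2" "i \<noteq> j" for i j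
        using that unfolding S_def by blast
      fix p assume "p \<in> ?A \<union> ?B \<union> ?C"
      then have "p \<in> S"
      proof (elim UnE)
        assume "p \<in> ?A"
        then obtain i j where "i < d1" "j < d1" "i \<noteq> j" "p = ({i, j}, Red)" by blast
        then show ?thesis using mem[of i j] by simp
      next
        assume "p \<in> ?B"
        then obtain i j where "i \<in> {d1..<d1 + d2}" "j \<in> {d1..<d1 + d2}" "i \<noteq> j" "p = ({i, j}, Red)"
          by blast
        then show ?thesis using mem[of i j] by simp
      next
        assume "p \<in> ?C"
        then obtain i j where "i < d1" "j \<in> {d1..<d1 + d2}" "p = ({i, j}, Green)" by blast
        then show ?thesis using mem[of i j] by simp
      qed
      then show "p \<in> ?S" unfolding S_def .
    qed
    then have "G \<cong>\<^sub>G graph_bichromatic d1 d2"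
      using iso by (simp add: graph_bichromatic_def)
    then show ?thesis using False \<open>1 \<le> d1\<close> m by (metis One_nat_def Suc_leI neq0_conv)
  qed
qed

definition classical_or_bichromatic :: "nat \<Rightarrow> standard_graph \<Rightarrow> bool" where
  "classical_or_bichromatic n H \<longleftrightarrow>
    (\<exists>m. 1 \<le> m \<and> m \<le> n \<and> H \<in> {graph_A m, graph_D m, graph_BC m}) \<or>
    (\<exists>d1 d2. 1 \<le> d1 \<and> 1 \<le> d2 \<and> d1 + d2 \<le> n \<and> H = graph_bichromatic d1 d2)"

lemma complete_crystallograph_classification:
  assumes G: "projective_crystallograph G" and fin: "finite (nodes G)"
    and K: "complete_graph G" and ne: "nodes G \<noteq> {}" and n: "card (nodes G) \<le> n"
  shows "\<exists>H. classical_or_bichromatic n H \<and> G \<cong>\<^sub>G H"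
proof -
  have m: "1 \<le> card (nodes G)"
    using fin ne by (simp add: Suc_le_eq card_gt_0_iff)
  consider (loop) x where "looped G x"
    | (doubled) x y where "\<And>k. \<not> looped G k" "joined G Red x y" "joined G Green x y"
    | (simple) "\<And>k. \<not> looped G k" "\<And>i j. \<not> (joined G Red i j \<and> joined G Green i j)"
    by blast
  then show ?thesis
  proof cases
    case loop
    show ?thesis
      using complete_looped_iso_BC[OF G fin K loop] m n
      by (intro exI[of _ "graph_BC (card (nodes G))"]) (auto simp: classical_or_bichromatic_def)
  next
    case doubled
    show ?thesis
      using complete_doubled_iso_D[OF G fin K doubled] m n
      by (intro exI[of _ "graph_D (card (nodes G))"]) (auto simp: classical_or_bichromatic_def)
  next
    case simple
    obtain x where "x \<in> nodes G" using ne by blast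
    from complete_simple_iso[OF G fin K simple this] show ?thesis
    proof (elim disjE exE conjE)
      assume "G \<cong>\<^sub>G graph_A (card (nodes G))"
      then show ?thesis
        using m n by (auto simp: classical_or_bichromatic_def)
    next
      fix d1 d2 assume "1 \<le> d1" "1 \<le> d2" "d1 + d2 = card (nodes G)" "G \<cong>\<^sub>G graph_bichromatic d1 d2"
      then show ?thesis
        using n unfolding classical_or_bichromatic_def by metis
    qed
  qed
qed

section \<open>Induced subgraphs and gluing\<close>

definition induced_subgraph :: "('v, 'e) coloured_graph \<Rightarrow> 'v set \<Rightarrow> ('v, 'e) coloured_graph" where
  "induced_subgraph G C = \<lparr>nodes = C, edges = {e \<in> edges G. ends G e \<subseteq> C},
     ends = ends G, colour = colour G\<rparr>"

lemma induced_subgraph_simps [simp]: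
  "nodes (induced_subgraph G C) = C"
  "edges (induced_subgraph G C) = {e \<in> edges G. ends G e \<subseteq> C}"
  "ends (induced_subgraph G C) = ends G"
  "colour (induced_subgraph G C) = colour G"
  by (simp_all add: induced_subgraph_def)

lemma straight_edge_induced [simp]:
  "straight_edge (induced_subgraph G C) e i j \<longleftrightarrow> straight_edge G e i j \<and> i \<in> C \<and> j \<in> C"
  by (auto simp: straight_edge_def)

lemma loop_edge_induced [simp]:
  "loop_edge (induced_subgraph G C) e k \<longleftrightarrow> loop_edge G e k \<and> k \<in> C"
  by (auto simp: loop_edge_def)

lemma joined_induced [simp]:
  "joined (induced_subgraph G C) c i j \<longleftrightarrow> joined G c i j \<and> i \<in> C \<and> j \<in> C"
  by (auto simp: joined_def)

text \<open>Both closure conditions only demand edges among nodes already named in their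
  hypotheses, so being a crystallograph is a hereditary property.\<close>

lemma crystallograph_induced:
  assumes G: "projective_crystallograph G"
  shows "projective_crystallograph (induced_subgraph G C)" (is "projective_crystallograph ?G'")
proof -
  have "coloured_multigraph (induced_subgraph G C)"
    unfolding coloured_multigraph_def
  proof
    fix e assume "e \<in> edges (induced_subgraph G C)"
    then have e: "e \<in> edges G" "ends G e \<subseteq> C" by simp_all
    from crystallograph_multigraph[OF G] e(1)
    show "(\<exists>i\<in>nodes (induced_subgraph G C). \<exists>j\<in>nodes (induced_subgraph G C).
        straight_edge (induced_subgraph G C) e i j) \<or>
      (\<exists>k\<in>nodes (induced_subgraph G C). loop_edge (induced_subgraph G C) e k)"
      using e(2)
      by (cases rule: ends_cases) (auto simp: straight_edge_def loop_edge_def)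
  qed
  moreover have "\<forall>e i j. straight_edge ?G' e i j \<longrightarrow> colour ?G' e = Red \<or> colour ?G' e = Green"
    using joined_colour[OF G] by (auto simp: joined_def)
  moreover have "\<forall>e k. loop_edge ?G' e k \<longrightarrow> colour ?G' e = Blue"
    using loop_edge_blue[OF G] by auto
  moreover have "\<forall>e\<in>edges ?G'. \<forall>f\<in>edges ?G'. e \<noteq> f \<longrightarrow> ends ?G' e = ends ?G' f \<longrightarrow>
      colour ?G' e \<noteq> colour ?G' f"
    using crystallograph_edge_eqI[OF G] by auto
  moreover have "\<forall>i j k e f. i \<noteq> k \<longrightarrow> straight_edge ?G' e i j \<longrightarrow> straight_edge ?G' f j k \<longrightarrow>
      (\<exists>g. straight_edge ?G' g i k \<and>
        colour ?G' g = (if colour ?G' e = colour ?G' f then Red else Green))"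
  proof (intro allI impI)
    fix i j k e f
    assume "i \<noteq> k" "straight_edge ?G' e i j" "straight_edge ?G' f j k"
    then have "joined ?G' (if colour G e = colour G f then Red else Green) i k"
      using joined_triangle[OF G, of "colour G e" i j "colour G f" k]
      unfolding joined_induced by (auto simp only: joined_def straight_edge_induced)
    then show "\<exists>g. straight_edge ?G' g i k \<and>
        colour ?G' g = (if colour ?G' e = colour ?G' f then Red else Green)"
      unfolding joined_def induced_subgraph_simps .
  qed
  moreover have "\<forall>i j l e. loop_edge ?G' l i \<longrightarrow> straight_edge ?G' e i j \<longrightarrow>
      (\<exists>r. straight_edge ?G' r i j \<and> colour ?G' r = Red) \<and>
      (\<exists>g. straight_edge ?G' g i j \<and> colour ?G' g = Green) \<and>
      (\<exists>b. loop_edge ?G' b j \<and> colour ?G' b = Blue)"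
  proof (intro allI impI)
    fix i j l e
    assume "loop_edge ?G' l i" "straight_edge ?G' e i j"
    then have ij: "i \<in> C" "j \<in> C" "looped G i" "joined G (colour G e) i j"
      by (auto simp: looped_def joined_def)
    obtain b where "loop_edge G b j"
      using looped_joined(3)[OF G ij(3,4)] unfolding looped_def by blast
    then have "\<exists>b. loop_edge ?G' b j \<and> colour ?G' b = Blue"
      using loop_edge_blue[OF G] ij(2) by auto
    moreover have "joined ?G' Red i j" "joined ?G' Green i j"
      using looped_joined(1,2)[OF G ij(3,4)] ij(1,2) by simp_all
    ultimately show "(\<exists>r. straight_edge ?G' r i j \<and> colour ?G' r = Red) \<and>
      (\<exists>g. straight_edge ?G' g i j \<and> colour ?G' g = Green) \<and>
      (\<exists>b. loop_edge ?G' b j \<and> colour ?G' b = Blue)"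
      unfolding joined_def by (intro conjI)
  qed
  ultimately show ?thesis
    unfolding projective_crystallograph_def by (intro conjI)
qed

lemma bij_betw_Sigma_of_partition:
  assumes F: "\<And>i. i \<in> I \<Longrightarrow> bij_betw (F i) (A i) (B i)"
    and A: "\<And>i. i \<in> I \<Longrightarrow> A i \<subseteq> S"
    and b: "\<And>v i. \<lbrakk>v \<in> S; i \<in> I\<rbrakk> \<Longrightarrow> v \<in> A i \<longleftrightarrow> b v = i" "\<And>v. v \<in> S \<Longrightarrow> b v \<in> I"
  shows "bij_betw (\<lambda>v. (b v, F (b v) v)) S (SIGMA i:I. B i)"
  unfolding bij_betw_def
proof (intro conjI equalityI subsetI)
  show "inj_on (\<lambda>v. (b v, F (b v) v)) S"
  proof (rule inj_onI)
    fix v w assume vw: "v \<in> S" "w \<in> S" "(b v, F (b v) v) = (b w, F (b w) w)"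
    then have "v \<in> A (b v)" "w \<in> A (b v)" "F (b v) v = F (b v) w"
      using b by auto
    then show "v = w"
      using bij_betw_imp_inj_on[OF F[OF b(2)[OF vw(1)]]] by (auto dest: inj_onD)
  qed
next
  fix p assume "p \<in> (\<lambda>v. (b v, F (b v) v)) ` S"
  then obtain v where v: "v \<in> S" "p = (b v, F (b v) v)" by blast
  then have "b v \<in> I" "v \<in> A (b v)" using b by auto
  then show "p \<in> (SIGMA i:I. B i)"
    using v(2) bij_betwE[OF F] by simp
next
  fix p assume "p \<in> (SIGMA i:I. B i)"
  then obtain i y where p: "p = (i, y)" "i \<in> I" "y \<in> B i" by blast
  then have "y \<in> F i ` A i"
    using bij_betw_imp_surj_on[OF F[OF p(2)]] by simp
  then obtain v where v: "v \<in> A i" "F i v = y" by auto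
  have "v \<in> S" using A[OF p(2)] v(1) by blast
  moreover from this have "b v = i" using b(1) p(2) v(1) by simp
  ultimately have "v \<in> S" "p = (b v, F (b v) v)" using p v by simp_all
  then show "p \<in> (\<lambda>v. (b v, F (b v) v)) ` S" by blast
qed

definition isomorphism ::
    "('v \<Rightarrow> 'w) \<Rightarrow> ('e \<Rightarrow> 'f) \<Rightarrow> ('v, 'e) coloured_graph \<Rightarrow> ('w, 'f) coloured_graph \<Rightarrow> bool" where
  "isomorphism \<phi> \<psi> G H \<longleftrightarrow> bij_betw \<phi> (nodes G) (nodes H) \<and> bij_betw \<psi> (edges G) (edges H) \<and>
     (\<forall>e\<in>edges G. ends H (\<psi> e) = \<phi> ` ends G e \<and> colour H (\<psi> e) = colour G e)"

lemma graph_iso_iff: "G \<cong>\<^sub>G H \<longleftrightarrow> (\<exists>\<phi> \<psi>. isomorphism \<phi> \<psi> G H)"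
  by (simp add: graph_iso_def isomorphism_def)

text \<open>Every edge has a nonempty end set, so its block is unique and both nodes and edges are
  partitioned by the blocks; isomorphisms of the blocks can then be combined.\<close>

lemma iso_disjoint_union_of_partition:
  assumes fin: "finite P" and nodes: "\<Union>P = nodes G"
    and disj: "\<And>C D. \<lbrakk>C \<in> P; D \<in> P; C \<noteq> D\<rbrakk> \<Longrightarrow> C \<inter> D = {}"
    and edge: "\<And>e. e \<in> edges G \<Longrightarrow> ends G e \<noteq> {} \<and> (\<exists>C\<in>P. ends G e \<subseteq> C)"
    and iso: "\<And>C. C \<in> P \<Longrightarrow> \<exists>H. Q H \<and> induced_subgraph G C \<cong>\<^sub>G H"
  shows "\<exists>(k::nat) H. (\<forall>i<k. Q (H i)) \<and> G \<cong>\<^sub>G disjoint_union {..<k} H"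
proof -
  obtain k and B :: "nat \<Rightarrow> 'a set" where B: "bij_betw B {..<k} P"
    using ex_bij_betw_nat_finite[OF fin] by (metis atLeast0LessThan)
  have BP: "B i \<in> P" if "i < k" for i
    using that B by (auto dest: bij_betwE)
  have B_onto: "\<exists>i<k. C = B i" if "C \<in> P" for C
    using that B by (auto simp: bij_betw_def)
  have B_unique: "i = j" if "i < k" "j < k" "v \<in> B i" "v \<in> B j" for i j v
  proof -
    have "B i = B j" using disj[OF BP[OF that(1)] BP[OF that(2)]] that(3,4) by auto
    then show ?thesis using bij_betw_imp_inj_on[OF B] that(1,2) by (simp add: inj_on_eq_iff)
  qed
  have "\<forall>i. \<exists>H \<phi> \<psi>. i < k \<longrightarrow> Q H \<and> isomorphism \<phi> \<psi> (induced_subgraph G (B i)) H"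
    using iso[OF BP] unfolding graph_iso_iff by metis
  then obtain H \<phi> \<psi> where H: "\<And>i. i < k \<Longrightarrow> Q (H i)"
    and isom: "\<And>i. i < k \<Longrightarrow> isomorphism (\<phi> i) (\<psi> i) (induced_subgraph G (B i)) (H i)"
    by metis
  have \<phi>: "bij_betw (\<phi> i) (B i) (nodes (H i))"
    and \<psi>: "bij_betw (\<psi> i) {e \<in> edges G. ends G e \<subseteq> B i} (edges (H i))" if "i < k" for i
    using isom[OF that] by (simp_all add: isomorphism_def)
  have comp: "ends (H i) (\<psi> i e) = \<phi> i ` ends G e" "colour (H i) (\<psi> i e) = colour G e"
    if "i < k" "e \<in> edges G" "ends G e \<subseteq> B i" for i e
    using isom[OF that(1)] that(2,3) by (simp_all add: isomorphism_def)
  have "\<forall>v\<in>nodes G. \<exists>i<k. v \<in> B i"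
    using nodes B_onto by (metis UnionE)
  then obtain b where b: "\<And>v. v \<in> nodes G \<Longrightarrow> b v < k \<and> v \<in> B (b v)"
    by metis
  have "\<forall>e\<in>edges G. \<exists>i<k. ends G e \<subseteq> B i"
    using edge B_onto by metis
  then obtain d where d: "\<And>e. e \<in> edges G \<Longrightarrow> d e < k \<and> ends G e \<subseteq> B (d e)"
    by metis
  have nodeset: "B i \<subseteq> nodes G" if "i < k" for i
    using BP[OF that] nodes by blast
  have bd: "b v = d e" if "e \<in> edges G" "v \<in> ends G e" for e v
  proof -
    have v: "d e < k" "v \<in> B (d e)" using d[OF that(1)] that(2) by auto
    then have "v \<in> nodes G" using nodeset by blast
    then show ?thesis using b v B_unique by blast
  qed
  let ?\<phi> = "\<lambda>v. (b v, \<phi> (b v) v)" and ?\<psi> = "\<lambda>e. (d e, \<psi> (d e) e)"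
  have "bij_betw ?\<phi> (nodes G) (SIGMA i:{..<k}. nodes (H i))"
  proof (rule bij_betw_Sigma_of_partition)
    show "v \<in> B i \<longleftrightarrow> b v = i" if "v \<in> nodes G" "i \<in> {..<k}" for v i
      using b[OF that(1)] that(2) B_unique[of "b v" i v] by auto
  qed (use \<phi> nodeset b in auto)
  moreover have "bij_betw ?\<psi> (edges G) (SIGMA i:{..<k}. edges (H i))"
  proof (rule bij_betw_Sigma_of_partition)
    show "e \<in> {e \<in> edges G. ends G e \<subseteq> B i} \<longleftrightarrow> d e = i" if "e \<in> edges G" "i \<in> {..<k}" for e i
    proof -
      obtain v where "v \<in> ends G e" using edge[OF \<open>e \<in> edges G\<close>] by blast
      then show ?thesis using d[OF that(1)] that B_unique[of "d e" i v] by auto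
    qed
  qed (use \<psi> d in auto)
  moreover have "Pair (d e) ` ends (H (d e)) (\<psi> (d e) e) = ?\<phi> ` ends G e"
    "colour (H (d e)) (\<psi> (d e) e) = colour G e" if "e \<in> edges G" for e
    using comp[of "d e" e] d[OF that] that bd[OF that] by (auto simp: image_image)
  ultimately have "isomorphism ?\<phi> ?\<psi> G (disjoint_union {..<k} H)"
    by (simp add: isomorphism_def disjoint_union_def)
  then have "G \<cong>\<^sub>G disjoint_union {..<k} H"
    unfolding graph_iso_iff by blast
  then show ?thesis using H by blast
qed

section \<open>Decomposition into complete pieces\<close>

definition adjacency :: "('v, 'e) coloured_graph \<Rightarrow> ('v \<times> 'v) set" where
  "adjacency G = {(i, j). i \<in> nodes G \<and> j \<in> nodes G \<and> (i = j \<or> (\<exists>c. joined G c i j))}"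

lemma equiv_adjacency:
  assumes G: "projective_crystallograph G"
  shows "equiv (nodes G) (adjacency G)"
proof (rule equivI)
  show "adjacency G \<subseteq> nodes G \<times> nodes G" "refl_on (nodes G) (adjacency G)"
    by (auto simp: adjacency_def refl_on_def)
  show "sym (adjacency G)"
    using joined_sym unfolding adjacency_def sym_def by fast
  show "trans (adjacency G)"
  proof (rule transI)
    fix i j k assume ij: "(i, j) \<in> adjacency G" and jk: "(j, k) \<in> adjacency G"
    show "(i, k) \<in> adjacency G"
    proof (cases "i = j \<or> j = k \<or> i = k")
      case True
      then show ?thesis using ij jk by (auto simp: adjacency_def)
    next
      case False
      then obtain c d where "joined G c i j" "joined G d j k"
        using ij jk by (auto simp: adjacency_def)
      then have "\<exists>c. joined G c i k"
        using joined_triangle[OF G] False by blast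
      then show ?thesis using ij jk by (simp add: adjacency_def)
    qed
  qed
qed

theorem corollary7p2p3:
  fixes G :: "('v, 'e) coloured_graph" and n :: nat
  assumes "projective_crystallograph G" and "card (nodes G) = n" and "n \<ge> 1"
  shows "\<exists>(k::nat) H.
    (\<forall>i<k. (\<exists>m. 1 \<le> m \<and> m \<le> n \<and> H i \<in> {graph_A m, graph_D m, graph_BC m}) \<or>
           (\<exists>d1 d2. 1 \<le> d1 \<and> 1 \<le> d2 \<and> d1 + d2 \<le> n \<and> H i = graph_bichromatic d1 d2)) \<and>
    G \<cong>\<^sub>G disjoint_union {..<k} H"
proof -
  let ?P = "nodes G // adjacency G"
  note G = assms(1) and eq = equiv_adjacency[OF assms(1)]
  have fin: "finite (nodes G)"
    using assms(2,3) by (intro card_ge_0_finite) simp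
  have "\<exists>(k::nat) H. (\<forall>i<k. classical_or_bichromatic n (H i)) \<and> G \<cong>\<^sub>G disjoint_union {..<k} H"
  proof (rule iso_disjoint_union_of_partition)
    show "finite ?P"
      using fin by (rule finite_quotient) (auto simp: adjacency_def)
    show "\<Union>?P = nodes G"
      using eq by (rule Union_quotient)
    show "C \<inter> D = {}" if "C \<in> ?P" "D \<in> ?P" "C \<noteq> D" for C D
      using quotient_disj[OF eq that(1,2)] that(3) by blast
    show "ends G e \<noteq> {} \<and> (\<exists>C\<in>?P. ends G e \<subseteq> C)" if e: "e \<in> edges G" for e
      using crystallograph_multigraph[OF G] e
    proof (cases rule: ends_cases)
      case (straight i j)
      then have "ends G e \<subseteq> adjacency G `` {i}"
        by (auto simp: adjacency_def joined_def straight_edge_def)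
      then show ?thesis
        using straight by (auto simp: straight_edge_def intro: quotientI)
    next
      case (loop k)
      then have "ends G e \<subseteq> adjacency G `` {k}"
        by (auto simp: adjacency_def loop_edge_def)
      then show ?thesis
        using loop by (auto simp: loop_edge_def intro: quotientI)
    qed
    show "\<exists>H. classical_or_bichromatic n H \<and> induced_subgraph G C \<cong>\<^sub>G H" if C: "C \<in> ?P" for C
    proof (rule complete_crystallograph_classification)
      have sub: "C \<subseteq> nodes G"
        using C Union_quotient[OF eq] by blast
      show "projective_crystallograph (induced_subgraph G C)"
        using G by (rule crystallograph_induced)
      show "finite (nodes (induced_subgraph G C))"
        using finite_subset[OF sub fin] by simp
      show "nodes (induced_subgraph G C) \<noteq> {}"
        using in_quotient_imp_non_empty[OF eq C] by simp
      show "card (nodes (induced_subgraph G C)) \<le> n"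
        using card_mono[OF fin sub] assms(2) by simp
      show "complete_graph (induced_subgraph G C)"
        using in_quotient_imp_in_rel[OF eq C]
        by (auto simp: complete_graph_def adjacency_def)
    qed
  qed
  then show ?thesis
    unfolding classical_or_bichromatic_def .
qed

end
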